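(* (Sum rule) Let $Q$ and $C$ be convex subsets of a real vector space such that $Q\cap C\neq\emptyset$, both $Q$ and $C$ are symmetric with respect to a point $x_0\in Q\cap C$, and $\operatorname{span}(C-x_0)=\operatorname{span}(Q-x_0)$. Let $\mu$ be the Minkowski functional of $C-x_0$ and $\nu$ the Minkowski functional of $Q-x_0$. Let $\varphi:C\to\mathbb{R}$ be a $\mu$-Lipschitz function and $f:Q\to\mathbb{R}$ be a $\nu$-Lipschitz function. Then for all $x\in B_\mu(x_0,1)\cap B_\nu(x_0,1)$, $$\partial^{\mu+\nu}_C(\varphi+f)(x)\subset\partial^\mu_C\varphi(x)+\partial^\nu_Cf(x).$$
   Context: A convex set $D$ is symmetric with respect to $x_0\in D$ if $D-x_0=-(D-x_0)$. Put $X_0:=\operatorname{span}(C-x_0)=\operatorname{span}(Q-x_0)$, with algebraic dual $X_0'$. The Minkowski functional of a set $D$ is $\mu_D(v)=\inf\{t>0:v\in tD\}$; $\mu$ and $\nu$ are finite seminorms on $X_0$. For a seminorm $q$ on $X_0$: $B_q(x_0,1):=\{x\in x_0+X_0:q(x-x_0)<1\}$ (so $B_\mu(x_0,1)\subset C$, $B_\nu(x_0,1)\subset Q$); a function $h$ is $q$-Lipschitz on its domain if for some $L>0$, $|h(x)-h(y)|\le Lq(x-y)$ for all $x,y$ in the domain; and the generalized derivative and subdifferential with respect to $q$ are $$h^\circ(x,v):=\limsup_{q(y-x)\to0,\ t\to0+}\frac{h(y+tv)-h(y)}{t},\qquad\partial^q_Ch(x):=\{\zeta\in X_0':h^\circ(x,v)\ge\langle\zeta,v\rangle\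 \forall v\in X_0\}.$$ These are used with $(h,q)=(\varphi,\mu)$, $(f,\nu)$ and $(\varphi+f,\mu+\nu)$, where $\varphi+f$ is defined on $Q\cap C$. The subscript $C$ in $\partial_C$ stands for "Clarke". *)

theory Defs
  imports "HOL-Analysis.Analysis" "HOL-Library.Set_Algebras" "HOL-Library.Function_Algebras"
begin

definition symmetric_about :: "'a::real_vector set \<Rightarrow> 'a \<Rightarrow> bool" where
  "symmetric_about D x0 \<longleftrightarrow> (\<lambda>x. x - x0) ` D = uminus ` (\<lambda>x. x - x0) ` D"

text \<open>Real-valued: only meaningful at vectors absorbed by \<open>D\<close>, since the infimum of the
  empty set of reals is unspecified.\<close>

definition minkowski :: "'a::real_vector set \<Rightarrow> 'a \<Rightarrow> real" where
  "minkowski D v = Inf {t. t > 0 \<and> v \<in> (\<lambda>x. t *\<^sub>R x) ` D}"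

definition seminorm_ball :: "'a::real_vector set \<Rightarrow> ('a \<Rightarrow> real) \<Rightarrow> 'a \<Rightarrow> real \<Rightarrow> 'a set" where
  "seminorm_ball X0 q x0 r = {x. x - x0 \<in> X0 \<and> q (x - x0) < r}"

definition seminorm_lipschitz_on ::
    "('a::real_vector \<Rightarrow> real) \<Rightarrow> 'a set \<Rightarrow> ('a \<Rightarrow> real) \<Rightarrow> bool" where
  "seminorm_lipschitz_on q D h \<longleftrightarrow>
     (\<exists>L>0. \<forall>x\<in>D. \<forall>y\<in>D. \<bar>h x - h y\<bar> \<le> L * q (x - y))"

text \<open>A functional on the subspace \<open>X0\<close> is represented by its extension by \<open>0\<close> outside
  \<open>X0\<close>. This makes the representation unique, and pointwise addition on the whole type is
  then the addition of \<open>X0'\<close>.\<close>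

definition algebraic_dual :: "'a::real_vector set \<Rightarrow> ('a \<Rightarrow> real) set" where
  "algebraic_dual X0 = {\<zeta>.
     (\<forall>u\<in>X0. \<forall>v\<in>X0. \<zeta> (u + v) = \<zeta> u + \<zeta> v) \<and>
     (\<forall>c. \<forall>v\<in>X0. \<zeta> (c *\<^sub>R v) = c * \<zeta> v) \<and>
     (\<forall>v. v \<notin> X0 \<longrightarrow> \<zeta> v = 0)}"

text \<open>Upper limit for \<open>q (y - x) \<rightarrow> 0\<close>, \<open>t \<rightarrow> 0+\<close>, over those pairs \<open>(y, t)\<close> for which the
  quotient is defined, where \<open>D\<close> is the domain of \<open>h\<close>; \<open>y\<close> with \<open>q (y - x) = 0\<close> (in
  particular \<open>y = x\<close>) is allowed. If \<open>D\<close> lies in \<open>x + X0\<close> and contains a \<open>q\<close>-ball around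
  \<open>x\<close> in \<open>x + X0\<close>, and \<open>v \<in> X0\<close>, the membership restriction only says
  \<open>y \<in> x + X0\<close> near the limit.\<close>

definition clarke_derivative ::
    "('a::real_vector \<Rightarrow> real) \<Rightarrow> 'a set \<Rightarrow> ('a \<Rightarrow> real) \<Rightarrow> 'a \<Rightarrow> 'a \<Rightarrow> ereal" where
  "clarke_derivative q D h x v =
     Limsup (inf (filtercomap (\<lambda>(y, t). (q (y - x), t)) (nhds 0 \<times>\<^sub>F at_right (0::real)))
                 (principal {(y, t). y \<in> D \<and> y + t *\<^sub>R v \<in> D}))
       (\<lambda>(y, t). ereal ((h (y + t *\<^sub>R v) - h y) / t))"

definition clarke_subdifferential ::
    "'a::real_vector set \<Rightarrow> ('a \<Rightarrow> real) \<Rightarrow> 'a set \<Rightarrow> ('a \<Rightarrow> real) \<Rightarrow> 'a \<Rightarrow> ('a \<Rightarrow> real) set" where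
  "clarke_subdifferential X0 q D h x =
     {\<zeta> \<in> algebraic_dual X0. \<forall>v\<in>X0. clarke_derivative q D h x v \<ge> ereal (\<zeta> v)}"

end

theory Submission
  imports Defs
begin

text \<open>The Clarke derivatives \<open>\<phi>\<degree>(x, \<cdot>)\<close> and \<open>f\<degree>(x, \<cdot>)\<close> are finite sublinear functionals on
  \<open>X0\<close> whose sum dominates \<open>(\<phi> + f)\<degree>(x, \<cdot>)\<close>, because \<open>(\<mu> + \<nu>)(y - x) \<rightarrow> 0\<close> forces both
  seminorms to tend to \<open>0\<close>. By the Hahn--Banach theorem, a linear functional below a sum of two
  sublinear ones splits into linear functionals below each of them. Hahn--Banach itself holds
  because a minimal sublinear functional is linear.\<close>

section \<open>Sublinear functionals\<close>

text \<open>Homogeneity is asked only as an inequality for \<open>c > 0\<close>: using it also with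
  \<open>inverse c\<close> recovers equality, so each instance has a single direction to check. The
  set \<open>S\<close> appears because Clarke derivatives are controlled on \<open>X0\<close>
  alone.\<close>

definition sublinear_on :: "'a::real_vector set \<Rightarrow> ('a \<Rightarrow> real) \<Rightarrow> bool" where
  "sublinear_on S p \<longleftrightarrow>
     (\<forall>u\<in>S. \<forall>v\<in>S. p (u + v) \<le> p u + p v) \<and> (\<forall>c>0. \<forall>v\<in>S. p (c *\<^sub>R v) \<le> c * p v)"

lemma sublinear_onI:
  assumes "\<And>u v. u \<in> S \<Longrightarrow> v \<in> S \<Longrightarrow> p (u + v) \<le> p u + p v"
    and "\<And>c v. c > 0 \<Longrightarrow> v \<in> S \<Longrightarrow> p (c *\<^sub>R v) \<le> c * p v"
  shows "sublinear_on S p"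
  using assms by (simp add: sublinear_on_def)

lemma sublinear_on_add: "sublinear_on S p \<Longrightarrow> u \<in> S \<Longrightarrow> v \<in> S \<Longrightarrow> p (u + v) \<le> p u + p v"
  by (simp add: sublinear_on_def)

lemma sublinear_on_scale_le: "sublinear_on S p \<Longrightarrow> c > 0 \<Longrightarrow> v \<in> S \<Longrightarrow> p (c *\<^sub>R v) \<le> c * p v"
  by (simp add: sublinear_on_def)

lemma sublinear_zero:
  assumes "sublinear_on UNIV p"
  shows "p 0 = 0"
proof -
  \<comment> \<open>The factor 2 makes \<open>p 0\<close> nonnegative, the factor 1/2 makes it
    nonpositive.\<close>
  have "p 0 \<le> 2 * p 0" "p 0 \<le> (1/2) * p 0"
    using sublinear_on_scale_le[OF assms, of 2 0] sublinear_on_scale_le[OF assms, of "1/2" 0]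
    by simp_all
  then show ?thesis by linarith
qed

lemma sublinear_scale:
  assumes "sublinear_on UNIV p" "c \<ge> 0"
  shows "p (c *\<^sub>R v) = c * p v"
proof (cases "c = 0")
  case True
  then show ?thesis using sublinear_zero[OF assms(1)] by simp
next
  case False
  then have c: "c > 0" using assms(2) by simp
  have "p (inverse c *\<^sub>R (c *\<^sub>R v)) \<le> inverse c * p (c *\<^sub>R v)"
    using sublinear_on_scale_le[OF assms(1), of "inverse c" "c *\<^sub>R v"] c by simp
  then have "c * p v \<le> p (c *\<^sub>R v)"
    using c by (simp add: field_simps)
  moreover have "p (c *\<^sub>R v) \<le> c * p v"
    using sublinear_on_scale_le[OF assms(1) c] by simp
  ultimately show ?thesis by simp
qed

lemma sublinear_uminus:
  assumes "sublinear_on UNIV p"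
  shows "- p (- v) \<le> p v"
  using sublinear_on_add[OF assms, of v "- v"] sublinear_zero[OF assms] by simp

section \<open>Minimal sublinear functionals and the Hahn--Banach theorem\<close>

lemma sublinear_INF_chain:
  assumes ne: "F \<noteq> {}" and sub: "\<And>s. s \<in> F \<Longrightarrow> sublinear_on UNIV s"
    and bdd: "\<And>v. bdd_below ((\<lambda>s. s v) ` F)"
    and chain: "\<And>s s'. s \<in> F \<Longrightarrow> s' \<in> F \<Longrightarrow> s \<le> s' \<or> s' \<le> s"
  shows "sublinear_on UNIV (\<lambda>v. INF s\<in>F. s v)"
proof (rule sublinear_onI)
  fix u v :: 'a
  \<comment> \<open>Infima of sublinear functionals need not be subadditive, since \<open>u\<close>
    and \<open>v\<close> may call for different members. In a chain the smaller member
    \<open>m\<close> of any two serves both; afterwards the infima over \<open>s'\<close> and over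
    \<open>s\<close> are taken one after the other.\<close>
  have *: "(INF s\<in>F. s (u + v)) \<le> s u + s' v" if s: "s \<in> F" "s' \<in> F" for s s'
  proof -
    obtain m where m: "m \<in> F" "m \<le> s" "m \<le> s'" using chain[OF s] s by blast
    have "(INF s\<in>F. s (u + v)) \<le> m (u + v)" by (rule cINF_lower[OF bdd m(1)])
    also have "\<dots> \<le> m u + m v" using sublinear_on_add[OF sub[OF m(1)]] by simp
    also have "\<dots> \<le> s u + s' v" using m(2,3) by (intro add_mono) (auto simp: le_fun_def)
    finally show ?thesis .
  qed
  have "(INF s\<in>F. s (u + v)) - s u \<le> (INF s\<in>F. s v)" if "s \<in> F" for s
    by (rule cINF_greatest[OF ne]) (use *[OF that] in \<open>simp add: algebra_simps\<close>)
  then have "(INF s\<in>F. s (u + v)) - (INF s\<in>F. s v) \<le> s u" if "s \<in> F" for s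
    using that by (simp add: algebra_simps)
  then have "(INF s\<in>F. s (u + v)) - (INF s\<in>F. s v) \<le> (INF s\<in>F. s u)"
    by (intro cINF_greatest[OF ne])
  then show "(INF s\<in>F. s (u + v)) \<le> (INF s\<in>F. s u) + (INF s\<in>F. s v)"
    by simp
next
  fix c :: real and v :: 'a
  assume c: "c > 0"
  have "(INF s\<in>F. s (c *\<^sub>R v)) / c \<le> s v" if "s \<in> F" for s
  proof -
    have "(INF s\<in>F. s (c *\<^sub>R v)) \<le> s (c *\<^sub>R v)" by (rule cINF_lower[OF bdd that])
    also have "\<dots> \<le> c * s v" using sublinear_on_scale_le[OF sub[OF that] c] by simp
    finally show ?thesis using c by (simp add: field_simps)
  qed
  then have "(INF s\<in>F. s (c *\<^sub>R v)) / c \<le> (INF s\<in>F. s v)" by (intro cINF_greatest[OF ne])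
  then show "(INF s\<in>F. s (c *\<^sub>R v)) \<le> c * (INF s\<in>F. s v)" using c by (simp add: field_simps)
qed

text \<open>Zorn's lemma for the reversed pointwise order on the sublinear functionals below
  \<open>p\<close>. A nonempty chain is bounded by its pointwise infimum, the empty one by
  \<open>p\<close> itself.\<close>

lemma minimal_sublinear_le:
  fixes p :: "'a::real_vector \<Rightarrow> real"
  assumes "sublinear_on UNIV p"
  obtains m where "sublinear_on UNIV m" "m \<le> p"
    "\<And>s. sublinear_on UNIV s \<Longrightarrow> s \<le> m \<Longrightarrow> s = m"
proof -
  define A where "A = {s. sublinear_on UNIV s \<and> s \<le> p}"
  have "\<exists>m\<in>A. \<forall>a\<in>A. a \<le> m \<longrightarrow> a = m"
  proof (rule predicate_Zorn[where P = "\<lambda>a b. b \<le> a"])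
    show "partial_order_on A (relation_of (\<lambda>a b. b \<le> a) A)"
      by (rule partial_order_on_relation_ofI) auto
  next
    fix F
    assume "F \<in> Chains (relation_of (\<lambda>a b. b \<le> a) A)"
    then have F: "\<And>s. s \<in> F \<Longrightarrow> s \<in> A"
      and chain: "\<And>s s'. s \<in> F \<Longrightarrow> s' \<in> F \<Longrightarrow> s \<le> s' \<or> s' \<le> s"
      by (auto simp: Chains_def relation_of_def)
    show "\<exists>u\<in>A. \<forall>a\<in>F. u \<le> a"
    proof (cases "F = {}")
      case True
      then show ?thesis using assms by (auto simp: A_def)
    next
      case False
      define u where "u = (\<lambda>v. INF s\<in>F. s v)"
      \<comment> \<open>Each \<open>s\<close> in the chain satisfies
        \<open>- p (- v) \<le> - s (- v) \<le> s v\<close>, a bound independent of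
        \<open>s\<close>.\<close>
      have bdd: "bdd_below ((\<lambda>s. s v) ` F)" for v
      proof (rule bdd_belowI2)
        fix s assume "s \<in> F"
        then have "sublinear_on UNIV s" "s (- v) \<le> p (- v)"
          using F by (auto simp: A_def le_fun_def)
        then show "- p (- v) \<le> s v" using sublinear_uminus[of s v] by linarith
      qed
      have le: "u \<le> a" if "a \<in> F" for a
        unfolding u_def le_fun_def using cINF_lower[OF bdd that] by simp
      moreover have "sublinear_on UNIV u"
        unfolding u_def using False F bdd chain
        by (intro sublinear_INF_chain) (auto simp: A_def)
      moreover obtain a where "a \<in> F" using False by blast
      then have "u \<le> p" using le[of a] F[of a] by (auto simp: A_def)
      ultimately show ?thesis by (auto simp: A_def)
    qed
  qed
  then obtain m where "m \<in> A" "\<And>a. a \<in> A \<Longrightarrow> a \<le> m \<Longrightarrow> a = m" by blast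
  then show thesis using that[of m] by (auto simp: A_def)
qed

text \<open>Minimality is tested against a functional \<open>g\<close> that may move any distance
  along \<open>w\<close> and subtracts \<open>s w\<close> per unit moved. It is sublinear and below
  \<open>s\<close>, hence equal to \<open>s\<close>, while its value at \<open>- w\<close> is at
  most \<open>- s w\<close>.\<close>

lemma minimal_sublinear_odd:
  fixes s :: "'a::real_vector \<Rightarrow> real"
  assumes s: "sublinear_on UNIV s"
    and min: "\<And>g. sublinear_on UNIV g \<Longrightarrow> g \<le> s \<Longrightarrow> g = s"
  shows "s (- w) = - s w"
proof -
  define g where "g v = (INF t\<in>{0..}. s (v + t *\<^sub>R w) - t * s w)" for v
  have bdd: "bdd_below ((\<lambda>t. s (v + t *\<^sub>R w) - t * s w) ` {0..})" for v
  proof (rule bdd_belowI2)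
    fix t :: real assume "t \<in> {0..}"
    then have "t * s w = s (v + t *\<^sub>R w + - v)" using sublinear_scale[OF s] by simp
    also have "\<dots> \<le> s (v + t *\<^sub>R w) + s (- v)" using sublinear_on_add[OF s] by blast
    finally show "- s (- v) \<le> s (v + t *\<^sub>R w) - t * s w" by simp
  qed
  have g_le: "g v \<le> s (v + t *\<^sub>R w) - t * s w" if "t \<ge> 0" for t v
    unfolding g_def by (rule cINF_lower[OF bdd]) (use that in simp)
  have g_ge: "r \<le> g v" if "\<And>t. t \<ge> 0 \<Longrightarrow> r \<le> s (v + t *\<^sub>R w) - t * s w" for r v
    unfolding g_def by (rule cINF_greatest) (use that in auto)
  have "sublinear_on UNIV g"
  proof (rule sublinear_onI)
    fix u v :: 'a
    have *: "g (u + v) \<le> (s (u + t *\<^sub>R w) - t * s w) + (s (v + t' *\<^sub>R w) - t' * s w)"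
      if "t \<ge> 0" "t' \<ge> 0" for t t'
    proof -
      have "g (u + v) \<le> s ((u + v) + (t + t') *\<^sub>R w) - (t + t') * s w"
        by (rule g_le) (use that in simp)
      also have "(u + v) + (t + t') *\<^sub>R w = (u + t *\<^sub>R w) + (v + t' *\<^sub>R w)"
        by (simp add: algebra_simps)
      also have "s \<dots> \<le> s (u + t *\<^sub>R w) + s (v + t' *\<^sub>R w)"
        using sublinear_on_add[OF s] by blast
      finally show ?thesis by (simp add: algebra_simps)
    qed
    have "g (u + v) - (s (u + t *\<^sub>R w) - t * s w) \<le> g v" if "t \<ge> 0" for t
      by (rule g_ge) (use *[OF that] in \<open>simp add: algebra_simps\<close>)
    then have "g (u + v) - g v \<le> g u"
      by (intro g_ge) (simp add: algebra_simps)
    then show "g (u + v) \<le> g u + g v" by simp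
  next
    fix c :: real and v :: 'a
    assume c: "c > 0"
    have "g (c *\<^sub>R v) / c \<le> g v"
    proof (rule g_ge)
      fix t :: real assume "t \<ge> 0"
      then have "g (c *\<^sub>R v) \<le> s (c *\<^sub>R v + (c * t) *\<^sub>R w) - (c * t) * s w"
        using c by (intro g_le) simp
      also have "c *\<^sub>R v + (c * t) *\<^sub>R w = c *\<^sub>R (v + t *\<^sub>R w)" by (simp add: algebra_simps)
      also have "s \<dots> = c * s (v + t *\<^sub>R w)" using sublinear_scale[OF s] c by simp
      finally show "g (c *\<^sub>R v) / c \<le> s (v + t *\<^sub>R w) - t * s w"
        using c by (simp add: field_simps)
    qed
    then show "g (c *\<^sub>R v) \<le> c * g v" using c by (simp add: field_simps)
  qed
  \<comment> \<open>The parameter \<open>t = 0\<close> gives this bound; below, \<open>t = 1\<close>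
    at the point \<open>- w\<close> gives \<open>s 0 - s w\<close>.\<close>
  moreover have "g \<le> s" using g_le[of 0] by (simp add: le_fun_def)
  ultimately have "g = s" by (rule min)
  then have "s (- w) \<le> - s w" using g_le[of 1 "- w"] sublinear_zero[OF s] by simp
  then show ?thesis using sublinear_uminus[OF s, of w] by linarith
qed

text \<open>A minimal sublinear functional below \<open>p\<close> is linear: oddness turns
  subadditivity at \<open>- u\<close> and \<open>- v\<close> into superadditivity at
  \<open>u\<close> and \<open>v\<close>, and carries homogeneity over to negative scalars.\<close>

theorem hahn_banach_sublinear:
  fixes p :: "'a::real_vector \<Rightarrow> real"
  assumes "sublinear_on UNIV p"
  obtains l where "linear l" "\<And>v. l v \<le> p v"
proof -
  obtain m where m: "sublinear_on UNIV m" "m \<le> p"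
    and min: "\<And>s. sublinear_on UNIV s \<Longrightarrow> s \<le> m \<Longrightarrow> s = m"
    using minimal_sublinear_le[OF assms] by blast
  have odd: "m (- w) = - m w" for w by (rule minimal_sublinear_odd[OF m(1) min])
  have "linear m"
  proof (rule linearI)
    fix u v
    have "m (- u + - v) \<le> m (- u) + m (- v)" "m (u + v) \<le> m u + m v"
      using sublinear_on_add[OF m(1)] by blast+
    then show "m (u + v) = m u + m v" using odd[of u] odd[of v] odd[of "u + v"] by simp
  next
    fix c :: real and v
    show "m (c *\<^sub>R v) = c *\<^sub>R m v"
    proof (cases "c \<ge> 0")
      case True
      then show ?thesis using sublinear_scale[OF m(1)] by simp
    next
      case False
      then have "m ((- c) *\<^sub>R v) = (- c) * m v" using sublinear_scale[OF m(1), of "- c" v] by simp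
      then show ?thesis using odd[of "c *\<^sub>R v"] by simp
    qed
  qed
  with m(2) show thesis using that[of m] by (simp add: le_fun_def)
qed

section \<open>Splitting a linear functional below a sum of sublinear functionals\<close>

text \<open>\<open>l\<close> comes from Hahn--Banach applied to the infimal convolution of \<open>p\<close> and
  \<open>w \<mapsto> q (- w) + k w\<close>.\<close>

lemma linear_le_sublinear_add:
  fixes p q k :: "'a::real_vector \<Rightarrow> real"
  assumes p: "sublinear_on UNIV p" and q: "sublinear_on UNIV q" and k: "linear k"
    and le: "\<And>v. k v \<le> p v + q v"
  obtains l where "linear l" "\<And>v. l v \<le> p v" "\<And>v. k v - l v \<le> q v"
proof -
  define r where "r v = (INF w. p (v - w) + (q (- w) + k w))" for v
  \<comment> \<open>The domination of \<open>k\<close> enters here: at \<open>- w\<close> it gives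
    \<open>- k w \<le> p (- w) + q (- w)\<close>, and
    \<open>p (- w) \<le> p (- v) + p (v - w)\<close>.\<close>
  have bdd: "bdd_below (range (\<lambda>w. p (v - w) + (q (- w) + k w)))" for v
  proof (rule bdd_belowI2)
    fix w
    have "p (- v + (v - w)) \<le> p (- v) + p (v - w)" using sublinear_on_add[OF p] by blast
    moreover have "k (- w) = - k w" using k by (rule linear_neg)
    ultimately show "- p (- v) \<le> p (v - w) + (q (- w) + k w)" using le[of "- w"] by simp
  qed
  have r_le: "r v \<le> p (v - w) + (q (- w) + k w)" for v w
    unfolding r_def by (rule cINF_lower[OF bdd]) simp
  have r_ge: "a \<le> r v" if "\<And>w. a \<le> p (v - w) + (q (- w) + k w)" for a v
    unfolding r_def by (rule cINF_greatest) (use that in auto)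
  have "sublinear_on UNIV r"
  proof (rule sublinear_onI)
    fix u v :: 'a
    have *: "r (u + v) \<le> (p (u - w) + (q (- w) + k w)) + (p (v - w') + (q (- w') + k w'))" for w w'
    proof -
      have "r (u + v) \<le> p ((u - w) + (v - w')) + (q (- w + - w') + k (w + w'))"
        using r_le[of "u + v" "w + w'"] by (simp add: algebra_simps)
      moreover have "p ((u - w) + (v - w')) \<le> p (u - w) + p (v - w')"
        using sublinear_on_add[OF p] by blast
      moreover have "q (- w + - w') \<le> q (- w) + q (- w')"
        using sublinear_on_add[OF q] by blast
      ultimately show ?thesis using linear_add[OF k, of w w'] by linarith
    qed
    have "r (u + v) - (p (u - w) + (q (- w) + k w)) \<le> r v" for w
      by (rule r_ge) (use *[of w] in \<open>simp add: algebra_simps\<close>)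
    then have "r (u + v) - r v \<le> r u"
      by (intro r_ge) (simp add: algebra_simps)
    then show "r (u + v) \<le> r u + r v" by simp
  next
    fix c :: real and v :: 'a
    assume c: "c > 0"
    have "r (c *\<^sub>R v) / c \<le> r v"
    proof (rule r_ge)
      fix w
      have "r (c *\<^sub>R v) \<le> p (c *\<^sub>R (v - w)) + (q (c *\<^sub>R (- w)) + k (c *\<^sub>R w))"
        using r_le[of "c *\<^sub>R v" "c *\<^sub>R w"] by (simp add: algebra_simps)
      also have "\<dots> = c * (p (v - w) + (q (- w) + k w))"
        using sublinear_scale[OF p, of c "v - w"] sublinear_scale[OF q, of c "- w"]
          linear_scale[OF k, of c w] c by (simp add: distrib_left)
      finally show "r (c *\<^sub>R v) / c \<le> p (v - w) + (q (- w) + k w)"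
        using c by (simp add: field_simps)
    qed
    then show "r (c *\<^sub>R v) \<le> c * r v" using c by (simp add: field_simps)
  qed
  then obtain l where l: "linear l" "\<And>v. l v \<le> r v" using hahn_banach_sublinear by blast
  show thesis
  proof (rule that[OF l(1)])
    fix v
    \<comment> \<open>The choice \<open>w = 0\<close> removes the terms in \<open>q\<close> and
      \<open>k\<close>. For the second bound, \<open>w = - v\<close> at the point \<open>- v\<close>
      removes the term in \<open>p\<close>.\<close>
    show "l v \<le> p v"
      using l(2)[of v] r_le[of v 0] sublinear_zero[OF q] linear_0[OF k] by simp
    have "l (- v) \<le> q v + k (- v)"
      using l(2)[of "- v"] r_le[of "- v" "- v"] sublinear_zero[OF p] by simp
    then show "k v - l v \<le> q v" using linear_neg[OF k, of v] linear_neg[OF l(1), of v] by simp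
  qed
qed

text \<open>Composition with a linear projection \<open>P\<close> onto \<open>S\<close> moves the
  data to the whole space, where the splitting is available; since \<open>P\<close> is the identity
  on \<open>S\<close>, the bounds there are the original ones.\<close>

lemma algebraic_dual_decompose:
  assumes S: "subspace S" and p: "sublinear_on S p" and q: "sublinear_on S q"
    and k: "k \<in> algebraic_dual S" and le: "\<And>v. v \<in> S \<Longrightarrow> k v \<le> p v + q v"
  obtains l m where "l \<in> algebraic_dual S" "m \<in> algebraic_dual S" "k = l + m"
    "\<And>v. v \<in> S \<Longrightarrow> l v \<le> p v" "\<And>v. v \<in> S \<Longrightarrow> m v \<le> q v"
proof -
  obtain P where P: "range P \<subseteq> S" "linear P" "\<And>v. v \<in> S \<Longrightarrow> P v = v"
    using linear_exists_left_inverse_on[OF linear_id S] by auto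
  have PS: "P v \<in> S" for v using P(1) by auto
  have P_add: "P (u + v) = P u + P v" and P_scale: "P (c *\<^sub>R v) = c *\<^sub>R P v" for u v c
    using P(2) by (auto simp: linear_add linear_scale)
  have sub: "sublinear_on UNIV (\<lambda>v. p' (P v))" if "sublinear_on S p'" for p' :: "'a \<Rightarrow> real"
    using that PS by (auto simp: sublinear_on_def P_add P_scale)
  have "linear (\<lambda>v. k (P v))"
    using k PS by (intro linearI) (auto simp: algebraic_dual_def P_add P_scale)
  then have "\<exists>l. linear l \<and> (\<forall>v. l v \<le> p (P v)) \<and> (\<forall>v. k (P v) - l v \<le> q (P v))"
    by (rule linear_le_sublinear_add[OF sub[OF p] sub[OF q] _ le[OF PS]]) blast
  then obtain l where l: "linear l" "\<And>v. l v \<le> p (P v)" "\<And>v. k (P v) - l v \<le> q (P v)"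
    by blast
  \<comment> \<open>Values off \<open>S\<close> are reset to 0, as the representation of dual
    elements demands. As \<open>k\<close> vanishes there too, \<open>k = l1 + m\<close> holds on the
    whole type.\<close>
  define l1 where "l1 v = (if v \<in> S then l v else 0)" for v
  define m where "m v = (if v \<in> S then k v - l v else 0)" for v
  show thesis
  proof (rule that)
    show "l1 \<in> algebraic_dual S" "m \<in> algebraic_dual S"
      using k S linear_add[OF l(1)] linear_scale[OF l(1)]
      by (auto simp: algebraic_dual_def l1_def m_def subspace_add subspace_scale algebra_simps)
    show "k = l1 + m" using k by (auto simp: algebraic_dual_def l1_def m_def)
    show "l1 v \<le> p v" "m v \<le> q v" if "v \<in> S" for v
      using l(2,3)[of v] P(3)[OF that] that by (simp_all add: l1_def m_def)
  qed
qed

section \<open>Minkowski functionals\<close>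

text \<open>The laws are restricted to \<open>S\<close> because a Minkowski functional is
  unspecified at vectors that are not absorbed. Nonnegativity follows from
  \<open>0 = q (v - v) \<le> 2 * q v\<close>.\<close>

locale seminorm_on =
  fixes S :: "'a::real_vector set" and q :: "'a \<Rightarrow> real"
  assumes S: "subspace S"
    and triangle: "u \<in> S \<Longrightarrow> v \<in> S \<Longrightarrow> q (u + v) \<le> q u + q v"
    and scale: "v \<in> S \<Longrightarrow> q (c *\<^sub>R v) = \<bar>c\<bar> * q v"
begin

lemma zero: "q 0 = 0"
  using scale[of 0 0] subspace_0[OF S] by simp

lemma nonneg: "v \<in> S \<Longrightarrow> 0 \<le> q v"
  using triangle[of v "- v"] scale[of v "-1"] zero subspace_neg[OF S, of v] by simp

end

text \<open>These are the properties of \<open>D - x0\<close> for a convex \<open>D\<close>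
  symmetric about \<open>x0\<close>. Absorption is meant relative to \<open>span K\<close> and is
  derived in \<open>span_absorbed\<close>.\<close>

locale absorbing_convex =
  fixes K :: "'a::real_vector set"
  assumes convex_K: "convex K" and zero_K: "0 \<in> K" and uminus_K: "v \<in> K \<Longrightarrow> - v \<in> K"
begin

text \<open>Convex combinations with 0 cover factors between 0 and 1; symmetry covers the negative
  ones.\<close>

lemma scale_K: "v \<in> K \<Longrightarrow> \<bar>c\<bar> \<le> 1 \<Longrightarrow> c *\<^sub>R v \<in> K"
proof -
  have *: "c *\<^sub>R v \<in> K" if "v \<in> K" "0 \<le> c" "c \<le> 1" for c v
    using convexD[OF convex_K that(1) zero_K that(2), of "1 - c"] that(3) by simp
  assume "v \<in> K" "\<bar>c\<bar> \<le> 1"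
  then show ?thesis
    using *[of v c] *[of "- v" "- c"] uminus_K[of v] by (cases "c \<ge> 0") auto
qed

lemma mem_scaled_iff: "t > 0 \<Longrightarrow> v \<in> (\<lambda>x. t *\<^sub>R x) ` K \<longleftrightarrow> (1 / t) *\<^sub>R v \<in> K"
  by (auto simp: image_iff intro!: bexI[of _ "(1 / t) *\<^sub>R v"])

lemma mem_scaled_mono:
  assumes "s > 0" "s \<le> t" "v \<in> (\<lambda>x. s *\<^sub>R x) ` K"
  shows "v \<in> (\<lambda>x. t *\<^sub>R x) ` K"
proof -
  have "(s / t) *\<^sub>R ((1 / s) *\<^sub>R v) \<in> K"
    by (rule scale_K) (use assms in \<open>simp_all add: mem_scaled_iff\<close>)
  then show ?thesis using assms by (simp add: mem_scaled_iff)
qed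

text \<open>The vector \<open>u + v\<close> divided by \<open>s + t\<close> is the convex
  combination of \<open>u / s\<close> and \<open>v / t\<close> with weights
  \<open>s / (s + t)\<close> and \<open>t / (s + t)\<close>.\<close>

lemma mem_scaled_add:
  assumes "s > 0" "t > 0" "u \<in> (\<lambda>x. s *\<^sub>R x) ` K" "v \<in> (\<lambda>x. t *\<^sub>R x) ` K"
  shows "u + v \<in> (\<lambda>x. (s + t) *\<^sub>R x) ` K"
proof -
  have "(s / (s + t)) *\<^sub>R ((1 / s) *\<^sub>R u) + (t / (s + t)) *\<^sub>R ((1 / t) *\<^sub>R v) \<in> K"
    using assms by (intro convexD[OF convex_K]) (simp_all add: mem_scaled_iff add_divide_distrib[symmetric])
  then show ?thesis using assms by (simp add: mem_scaled_iff scaleR_add_right)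
qed

lemma mem_scaled_scaleR:
  assumes "t > 0" "c \<noteq> 0" "v \<in> (\<lambda>x. t *\<^sub>R x) ` K"
  shows "c *\<^sub>R v \<in> (\<lambda>x. (\<bar>c\<bar> * t) *\<^sub>R x) ` K"
proof -
  have "(c / \<bar>c\<bar>) *\<^sub>R ((1 / t) *\<^sub>R v) \<in> K"
    by (rule scale_K) (use assms in \<open>simp_all add: mem_scaled_iff\<close>)
  then show ?thesis using assms by (simp add: mem_scaled_iff)
qed

text \<open>This makes the set under the infimum in \<open>minkowski\<close> nonempty on
  \<open>span K\<close>. Adding a multiple \<open>c\<close> of a generator enlarges the absorbing
  factor by \<open>\<bar>c\<bar>\<close>.\<close>

lemma span_absorbed:
  assumes "v \<in> span K"
  obtains t where "t > 0" "v \<in> (\<lambda>x. t *\<^sub>R x) ` K"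
proof -
  have "\<exists>t>0. v \<in> (\<lambda>x. t *\<^sub>R x) ` K"
    using assms
  proof (induction rule: span_induct_alt)
    case base
    show ?case using zero_K by (intro exI[of _ 1]) auto
  next
    case (step c x y)
    then obtain t where t: "t > 0" "y \<in> (\<lambda>x. t *\<^sub>R x) ` K" by blast
    show ?case
    \<comment> \<open>Scaling by 0 would give the factor 0, which is not admissible.\<close>
    proof (cases "c = 0")
      case True
      then show ?thesis using t by auto
    next
      case False
      have "x \<in> (\<lambda>x. 1 *\<^sub>R x) ` K" using step(1) by simp
      then have "c *\<^sub>R x \<in> (\<lambda>x. (\<bar>c\<bar> * 1) *\<^sub>R x) ` K"
        using False by (intro mem_scaled_scaleR) simp_all
      then have "c *\<^sub>R x + y \<in> (\<lambda>x. (\<bar>c\<bar> * 1 + t) *\<^sub>R x) ` K"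
        using False t by (intro mem_scaled_add) simp_all
      then show ?thesis using t(1) by (intro exI[of _ "\<bar>c\<bar> * 1 + t"]) simp
    qed
  qed
  then show thesis using that by blast
qed

lemma minkowski_le: "t > 0 \<Longrightarrow> v \<in> (\<lambda>x. t *\<^sub>R x) ` K \<Longrightarrow> minkowski K v \<le> t"
  unfolding minkowski_def by (rule cInf_lower) (auto intro: bdd_belowI[of _ 0])

text \<open>The infimum need not be attained; any number strictly above it leaves room for an actual
  scaling factor. The triangle inequality and homogeneity are therefore proved up to an arbitrary
  \<open>e > 0\<close>.\<close>

lemma mem_scaled_of_minkowski_less:
  assumes "v \<in> span K" "minkowski K v < s"
  obtains t where "t > 0" "t < s" "v \<in> (\<lambda>x. t *\<^sub>R x) ` K"
proof -
  obtain t0 where "t0 > 0" "v \<in> (\<lambda>x. t0 *\<^sub>R x) ` K" using span_absorbed[OF assms(1)] .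
  then have "{t. t > 0 \<and> v \<in> (\<lambda>x. t *\<^sub>R x) ` K} \<noteq> {}" by blast
  from cInf_lessD[OF this assms(2)[unfolded minkowski_def]]
  obtain t where "t > 0" "t < s" "v \<in> (\<lambda>x. t *\<^sub>R x) ` K" by blast
  then show thesis by (rule that)
qed

text \<open>This yields the inclusion of the unit ball in the domain. Strictness matters: a vector
  of value 1 may lie outside \<open>K\<close>.\<close>

lemma mem_of_minkowski_less_1:
  assumes "v \<in> span K" "minkowski K v < 1"
  shows "v \<in> K"
proof -
  obtain t where "t > 0" "t < 1" "v \<in> (\<lambda>x. t *\<^sub>R x) ` K"
    using mem_scaled_of_minkowski_less[OF assms] .
  then show ?thesis using mem_scaled_mono[of t 1 v] by simp
qed

lemma minkowski_nonneg:
  assumes "v \<in> span K"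
  shows "0 \<le> minkowski K v"
proof (rule ccontr)
  assume "\<not> 0 \<le> minkowski K v"
  then have less: "minkowski K v < 0" by simp
  obtain t where "t > 0" "t < 0" "v \<in> (\<lambda>x. t *\<^sub>R x) ` K"
    using mem_scaled_of_minkowski_less[OF assms less] .
  then show False by simp
qed

lemma minkowski_triangle:
  assumes "u \<in> span K" "v \<in> span K"
  shows "minkowski K (u + v) \<le> minkowski K u + minkowski K v"
proof (rule field_le_epsilon)
  fix e :: real assume "e > 0"
  then have "minkowski K u < minkowski K u + e/2" "minkowski K v < minkowski K v + e/2" by simp_all
  obtain s where s: "s > 0" "s < minkowski K u + e/2" "u \<in> (\<lambda>x. s *\<^sub>R x) ` K"
    using mem_scaled_of_minkowski_less[OF assms(1) \<open>minkowski K u < _\<close>] .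
  obtain t where t: "t > 0" "t < minkowski K v + e/2" "v \<in> (\<lambda>x. t *\<^sub>R x) ` K"
    using mem_scaled_of_minkowski_less[OF assms(2) \<open>minkowski K v < _\<close>] .
  have "minkowski K (u + v) \<le> s + t"
    using minkowski_le[OF _ mem_scaled_add[OF s(1) t(1) s(3) t(3)]] s(1) t(1) by simp
  then show "minkowski K (u + v) \<le> minkowski K u + minkowski K v + e"
    using s(2) t(2) by simp
qed

lemma minkowski_scale_le:
  assumes "v \<in> span K" "c \<noteq> 0"
  shows "minkowski K (c *\<^sub>R v) \<le> \<bar>c\<bar> * minkowski K v"
proof (rule field_le_epsilon)
  fix e :: real assume "e > 0"
  then have less: "minkowski K v < minkowski K v + e / \<bar>c\<bar>" using assms(2) by simp
  obtain t where t: "t > 0" "t < minkowski K v + e / \<bar>c\<bar>" "v \<in> (\<lambda>x. t *\<^sub>R x) ` K"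
    using mem_scaled_of_minkowski_less[OF assms(1) less] .
  have "minkowski K (c *\<^sub>R v) \<le> \<bar>c\<bar> * t"
    using t assms(2) by (intro minkowski_le mem_scaled_scaleR) simp_all
  also have "\<dots> \<le> \<bar>c\<bar> * (minkowski K v + e / \<bar>c\<bar>)"
    using t by (intro mult_left_mono) simp_all
  also have "\<dots> = \<bar>c\<bar> * minkowski K v + e" using assms(2) by (simp add: distrib_left)
  finally show "minkowski K (c *\<^sub>R v) \<le> \<bar>c\<bar> * minkowski K v + e" .
qed

lemma minkowski_zero: "minkowski K 0 = 0"
proof (rule antisym)
  show "minkowski K 0 \<le> 0"
    by (rule field_le_epsilon) (use zero_K in \<open>auto intro!: minkowski_le\<close>)
qed (rule minkowski_nonneg, rule span_zero)

sublocale seminorm_on "span K" "minkowski K"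
proof
  show "minkowski K (u + v) \<le> minkowski K u + minkowski K v"
    if "u \<in> span K" "v \<in> span K" for u v
    using that by (rule minkowski_triangle)
  show "minkowski K (c *\<^sub>R v) = \<bar>c\<bar> * minkowski K v" if v: "v \<in> span K" for c v
  proof (cases "c = 0")
    case True
    then show ?thesis by (simp add: minkowski_zero)
  next
    case False
    \<comment> \<open>Scaling \<open>c *\<^sub>R v\<close> back by \<open>1 / c\<close> turns the
      one-sided estimate into the reverse inequality.\<close>
    have "minkowski K ((1 / c) *\<^sub>R (c *\<^sub>R v)) \<le> \<bar>1 / c\<bar> * minkowski K (c *\<^sub>R v)"
      using False v by (intro minkowski_scale_le) (simp_all add: span_scale)
    then have "\<bar>c\<bar> * minkowski K v \<le> minkowski K (c *\<^sub>R v)"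
      using False by (simp add: field_simps abs_divide)
    then show ?thesis using minkowski_scale_le[OF v False] by simp
  qed
qed simp

end

lemma absorbing_convex_translate:
  assumes "convex D" "x0 \<in> D" "symmetric_about D x0"
  shows "absorbing_convex ((\<lambda>x. x - x0) ` D)"
proof
  show "convex ((\<lambda>x. x - x0) ` D)" using assms(1) by (simp add: convex_translation_subtract_eq)
  show "0 \<in> (\<lambda>x. x - x0) ` D" using assms(2) by force
  show "- v \<in> (\<lambda>x. x - x0) ` D" if "v \<in> (\<lambda>x. x - x0) ` D" for v
    using that assms(3) unfolding symmetric_about_def by (metis imageI)
qed

section \<open>Clarke derivatives\<close>

text \<open>Sets of the product filter contain products of neighbourhoods, and a minimum gives one
  \<delta> for both factors. Here \<open>q\<close> is an arbitrary function, hence the absolute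
  value.\<close>

lemma eventually_clarke_filter:
  "eventually P (inf (filtercomap (\<lambda>(y, t). (q (y - x), t)) (nhds 0 \<times>\<^sub>F at_right (0::real)))
      (principal A)) \<longleftrightarrow>
   (\<exists>\<delta>>0. \<forall>y t. \<bar>q (y - x)\<bar> < \<delta> \<longrightarrow> 0 < t \<longrightarrow> t < \<delta> \<longrightarrow> (y, t) \<in> A \<longrightarrow> P (y, t))"
  (is "?L \<longleftrightarrow> ?R")
proof
  assume ?L
  then obtain Pf Pg where "eventually Pf (nhds (0::real))" "eventually Pg (at_right (0::real))"
    and *: "\<And>y t. Pf (q (y - x)) \<Longrightarrow> Pg t \<Longrightarrow> (y, t) \<in> A \<Longrightarrow> P (y, t)"
    by (auto simp: eventually_inf_principal eventually_filtercomap eventually_prod_filter)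
  then obtain d1 d2 where d: "d1 > 0" "\<And>s. \<bar>s\<bar> < d1 \<Longrightarrow> Pf s"
    "d2 > 0" "\<And>t. 0 < t \<Longrightarrow> t < d2 \<Longrightarrow> Pg t"
    by (auto simp: eventually_nhds_metric eventually_at_right_field dist_real_def)
  show ?R
    using d by (intro exI[of _ "min d1 d2"]) (auto intro!: *)
next
  assume ?R
  then obtain d where d: "d > 0"
    "\<And>y t. \<bar>q (y - x)\<bar> < d \<Longrightarrow> 0 < t \<Longrightarrow> t < d \<Longrightarrow> (y, t) \<in> A \<Longrightarrow> P (y, t)" by blast
  have "eventually (\<lambda>s. \<bar>s\<bar> < d) (nhds (0::real))" "eventually (\<lambda>t. 0 < t \<and> t < d) (at_right (0::real))"
    using d(1) by (auto simp: eventually_nhds_metric eventually_at_right_field dist_real_def)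
  then have "eventually (\<lambda>(s, t). \<bar>s\<bar> < d \<and> 0 < t \<and> t < d) (nhds 0 \<times>\<^sub>F at_right (0::real))"
    unfolding eventually_prod_filter by blast
  then have "eventually (\<lambda>(y, t). \<bar>q (y - x)\<bar> < d \<and> 0 < t \<and> t < d)
      (filtercomap (\<lambda>(y, t). (q (y - x), t)) (nhds 0 \<times>\<^sub>F at_right (0::real)))"
    unfolding eventually_filtercomap by (rule_tac exI, rule_tac conjI, assumption) auto
  then show ?L
    unfolding eventually_inf_principal by eventually_elim (auto intro!: d(2))
qed

text \<open>All later estimates use this form, which avoids extended reals and, after multiplication
  by \<open>t > 0\<close>, quotients. The slack \<open>e\<close> absorbs the difference between
  strict and weak inequalities.\<close>

lemma clarke_derivative_le_iff:
  "clarke_derivative q D h x v \<le> ereal r \<longleftrightarrow>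
   (\<forall>e>0. \<exists>\<delta>>0. \<forall>y t. \<bar>q (y - x)\<bar> < \<delta> \<longrightarrow> 0 < t \<longrightarrow> t < \<delta> \<longrightarrow> y \<in> D \<longrightarrow> y + t *\<^sub>R v \<in> D \<longrightarrow>
      h (y + t *\<^sub>R v) - h y \<le> (r + e) * t)"
  (is "?L \<longleftrightarrow> ?R")
proof -
  let ?F = "inf (filtercomap (\<lambda>(y, t). (q (y - x), t)) (nhds 0 \<times>\<^sub>F at_right (0::real)))
                 (principal {(y, t). y \<in> D \<and> y + t *\<^sub>R v \<in> D})"
  let ?g = "\<lambda>(y, t). (h (y + t *\<^sub>R v) - h y) / t"
  have "?L \<longleftrightarrow> (\<forall>z>ereal r. eventually (\<lambda>w. ereal (?g w) < z) ?F)"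
    unfolding clarke_derivative_def by (subst Limsup_le_iff) (simp add: case_prod_unfold)
  also have "\<dots> \<longleftrightarrow> (\<forall>e>0. eventually (\<lambda>w. ?g w \<le> r + e) ?F)"
  proof (intro iffI allI impI)
    fix e :: real
    assume less: "\<forall>z>ereal r. eventually (\<lambda>w. ereal (?g w) < z) ?F" and e: "e > 0"
    have "eventually (\<lambda>w. ereal (?g w) < ereal (r + e)) ?F"
      by (rule less[rule_format]) (use e in simp)
    then show "eventually (\<lambda>w. ?g w \<le> r + e) ?F" by eventually_elim simp
  next
    fix z assume e: "\<forall>e>0. eventually (\<lambda>w. ?g w \<le> r + e) ?F" and z: "ereal r < z"
    \<comment> \<open>The bound \<open>z\<close> may be infinite, so a real number is placed
      strictly between \<open>r\<close> and \<open>z\<close>.\<close>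
    then obtain r' where r': "ereal r < ereal r'" "ereal r' < z" using ereal_dense2 by blast
    then have "eventually (\<lambda>w. ?g w \<le> r + (r' - r)) ?F"
      by (intro e[rule_format]) simp
    then show "eventually (\<lambda>w. ereal (?g w) < z) ?F"
    proof eventually_elim
      case (elim w)
      then have "ereal (?g w) \<le> ereal r'" by simp
      then show ?case using r'(2) by (rule le_less_trans)
    qed
  qed
  also have "\<dots> \<longleftrightarrow> ?R"
    unfolding eventually_clarke_filter by (simp add: pos_divide_le_eq imp_conjL)
  finally show ?thesis .
qed

lemma clarke_derivative_leD:
  assumes "clarke_derivative q D h x v \<le> ereal r" "e > 0"
  shows "\<exists>\<delta>>0. \<forall>y t. \<bar>q (y - x)\<bar> < \<delta> \<longrightarrow> 0 < t \<longrightarrow> t < \<delta> \<longrightarrow> y \<in> D \<longrightarrow> y + t *\<^sub>R v \<in> D \<longrightarrow>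
    h (y + t *\<^sub>R v) - h y \<le> (r + e) * t"
  using assms unfolding clarke_derivative_le_iff by blast

section \<open>Clarke derivative of a Lipschitz function at a point of the unit ball\<close>

locale clarke_setting = seminorm_on +
  fixes D :: "'a::real_vector set" and h :: "'a \<Rightarrow> real" and x0 x :: 'a
  assumes D_sub: "y \<in> D \<Longrightarrow> y - x0 \<in> S"
    and ball_sub: "seminorm_ball S q x0 1 \<subseteq> D"
    and lip: "seminorm_lipschitz_on q D h"
    and x: "x \<in> seminorm_ball S q x0 1"
begin

lemma x_diff: "x - x0 \<in> S" "q (x - x0) < 1"
  using x by (auto simp: seminorm_ball_def)

lemma D_diff: "y \<in> D \<Longrightarrow> y - x \<in> S"
  using subspace_diff[OF S D_sub x_diff(1)] by simp

text \<open>Moving the base point from \<open>y\<close> to \<open>y + t *\<^sub>R v\<close> costs at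
  most the factor \<open>1 + q v\<close> in the distance to \<open>x\<close>; later radii are
  divided by this factor.\<close>

lemma near_add:
  assumes "v \<in> S" "y - x \<in> S" "\<bar>q (y - x)\<bar> < \<delta>" "0 < t" "t < \<delta>"
  shows "y + t *\<^sub>R v - x \<in> S" "q (y + t *\<^sub>R v - x) < \<delta> * (1 + q v)"
proof -
  have tv: "t *\<^sub>R v \<in> S" using S assms(1) by (rule subspace_scale)
  have eq: "y + t *\<^sub>R v - x = (y - x) + t *\<^sub>R v" by simp
  show "y + t *\<^sub>R v - x \<in> S" unfolding eq using S assms(2) tv by (rule subspace_add)
  have "q (y + t *\<^sub>R v - x) \<le> q (y - x) + q (t *\<^sub>R v)"
    unfolding eq using assms(2) tv by (rule triangle)
  also have "q (t *\<^sub>R v) = t * q v" using assms(1,4) by (simp add: scale)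
  also have "\<dots> \<le> \<delta> * q v" using assms(5) nonneg[OF assms(1)] by (intro mult_right_mono) auto
  finally show "q (y + t *\<^sub>R v - x) < \<delta> * (1 + q v)" using assms(3) by (simp add: distrib_left)
qed

text \<open>By the triangle inequality, the ball about \<open>x\<close> of radius
  \<open>1 - q (x - x0)\<close> stays inside the unit ball about \<open>x0\<close>.\<close>

lemma near_mem:
  assumes "y - x \<in> S" "q (y - x) < 1 - q (x - x0)"
  shows "y \<in> D"
proof -
  have "y - x0 = (y - x) + (x - x0)" by simp
  then have "y - x0 \<in> S" "q (y - x0) \<le> q (y - x) + q (x - x0)"
    using triangle[OF assms(1) x_diff(1)] subspace_add[OF S assms(1) x_diff(1)] by simp_all
  then show ?thesis using assms ball_sub by (auto simp: seminorm_ball_def)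
qed

text \<open>The Lipschitz condition bounds every difference quotient by \<open>L * q v\<close> in
  absolute value. The lower bound also needs admissible pairs arbitrarily close to the limit, and
  \<open>y = x\<close> with small \<open>t\<close> provides them.\<close>

lemma clarke_derivative_finite:
  assumes v: "v \<in> S"
  shows "\<bar>clarke_derivative q D h x v\<bar> \<noteq> \<infinity>"
proof -
  obtain L where L: "L > 0" "\<And>y z. y \<in> D \<Longrightarrow> z \<in> D \<Longrightarrow> \<bar>h y - h z\<bar> \<le> L * q (y - z)"
    using lip by (auto simp: seminorm_lipschitz_on_def)
  have bound: "\<bar>h (y + t *\<^sub>R v) - h y\<bar> \<le> L * q v * t" if "t > 0" "y \<in> D" "y + t *\<^sub>R v \<in> D" for y t
    using L(2)[OF that(3,2)] that(1) v by (simp add: scale mult_ac)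
  have upper: "clarke_derivative q D h x v \<le> ereal (L * q v)"
    unfolding clarke_derivative_le_iff
  proof (intro allI impI exI conjI)
    fix e y and t :: real
    assume "e > (0::real)" "0 < t" "y \<in> D" "y + t *\<^sub>R v \<in> D"
    then show "h (y + t *\<^sub>R v) - h y \<le> (L * q v + e) * t"
      using bound[of t y] by (simp add: distrib_right) (smt (verit) mult_pos_pos)
  qed (rule zero_less_one)
  have lower: "- (L * q v) \<le> r" if le: "clarke_derivative q D h x v \<le> ereal r" for r
  proof (rule field_le_epsilon)
    fix e :: real assume e: "e > 0"
    obtain d where d: "d > 0" "\<And>y t. \<bar>q (y - x)\<bar> < d \<Longrightarrow> 0 < t \<Longrightarrow> t < d \<Longrightarrow> y \<in> D
        \<Longrightarrow> y + t *\<^sub>R v \<in> D \<Longrightarrow> h (y + t *\<^sub>R v) - h y \<le> (r + e) * t"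
      using clarke_derivative_leD[OF le e] by blast
    \<comment> \<open>For \<open>t < g\<close> the point \<open>x + t *\<^sub>R v\<close> is within
      \<open>1 - q (x - x0)\<close> of \<open>x\<close>, hence in \<open>D\<close>.\<close>
    define g where "g = (1 - q (x - x0)) / (1 + q v)"
    have pos: "1 + q v > 0" using nonneg[OF v] by simp
    have g: "g > 0" "g * (1 + q v) = 1 - q (x - x0)" using pos x_diff(2) by (auto simp: g_def)
    define t where "t = min d g / 2"
    have t: "0 < t" "t < d" "t < g" using d(1) g(1) by (auto simp: t_def min_def)
    have xD: "x \<in> D" using x ball_sub by blast
    have "x + t *\<^sub>R v \<in> D"
      using near_add[OF v, of x g t] t g zero subspace_0[OF S] by (intro near_mem) auto
    then have "h (x + t *\<^sub>R v) - h x \<le> (r + e) * t" "\<bar>h (x + t *\<^sub>R v) - h x\<bar> \<le> L * q v * t"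
      using d(2)[of x t] bound[of t x] t xD d(1) zero by auto
    then have "(- (L * q v)) * t \<le> (r + e) * t"
      unfolding mult_minus_left by linarith
    then show "- (L * q v) \<le> r + e" using t(1) by (rule mult_right_le_imp_le)
  qed
  \<comment> \<open>The value minus infinity would lie below \<open>- (L * q v) - 1\<close>,
    contradicting \<open>lower\<close>.\<close>
  have "clarke_derivative q D h x v \<noteq> - \<infinity>"
    using lower[of "- (L * q v) - 1"] by auto
  with upper show ?thesis by auto
qed

lemma clarke_derivative_real:
  "v \<in> S \<Longrightarrow> clarke_derivative q D h x v = ereal (real_of_ereal (clarke_derivative q D h x v))"
  using clarke_derivative_finite by (simp add: ereal_real)

text \<open>The increment along \<open>t *\<^sub>R (u + v)\<close> splits into one along
  \<open>v\<close> from \<open>y\<close> and one along \<open>u\<close> from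
  \<open>y + t *\<^sub>R v\<close>. The second is controlled because the upper limit lets the base
  point vary. Homogeneity is the substitution of \<open>t * c\<close> for \<open>t\<close>.\<close>

lemma sublinear_on_clarke_derivative:
  "sublinear_on S (\<lambda>v. real_of_ereal (clarke_derivative q D h x v))" (is "sublinear_on S ?p")
proof (rule sublinear_onI)
  have p: "clarke_derivative q D h x v \<le> ereal (?p v)" if "v \<in> S" for v
    using clarke_derivative_real[OF that] by simp
  have p_le: "?p v \<le> r" if "v \<in> S" "clarke_derivative q D h x v \<le> ereal r" for v r
    using clarke_derivative_real[OF that(1)] that(2) by (metis ereal_less_eq(3))
  fix u v assume u: "u \<in> S" and v: "v \<in> S"
  have "clarke_derivative q D h x (u + v) \<le> ereal (?p u + ?p v)"
    unfolding clarke_derivative_le_iff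
  proof (intro allI impI)
    fix e :: real assume "e > 0"
    then have e2: "e / 2 > 0" by simp
    obtain d1 where d1: "d1 > 0" "\<And>y t. \<bar>q (y - x)\<bar> < d1 \<Longrightarrow> 0 < t \<Longrightarrow> t < d1 \<Longrightarrow> y \<in> D
        \<Longrightarrow> y + t *\<^sub>R u \<in> D \<Longrightarrow> h (y + t *\<^sub>R u) - h y \<le> (?p u + e / 2) * t"
      using clarke_derivative_leD[OF p[OF u] e2] by blast
    obtain d2 where d2: "d2 > 0" "\<And>y t. \<bar>q (y - x)\<bar> < d2 \<Longrightarrow> 0 < t \<Longrightarrow> t < d2 \<Longrightarrow> y \<in> D
        \<Longrightarrow> y + t *\<^sub>R v \<in> D \<Longrightarrow> h (y + t *\<^sub>R v) - h y \<le> (?p v + e / 2) * t"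
      using clarke_derivative_leD[OF p[OF v] e2] by blast
    \<comment> \<open>For \<open>y\<close> and \<open>t\<close> within \<open>g\<close>, the shifted
      base point is within \<open>d1\<close> of \<open>x\<close> and still in \<open>D\<close>.
      Since \<open>1 + q v \<ge> 1\<close>, also \<open>g \<le> d1\<close>, so
      \<open>t < d1\<close>.\<close>
    define g where "g = min d1 (1 - q (x - x0)) / (1 + q v)"
    have pos: "1 + q v > 0" "1 + q v \<ge> 1" using nonneg[OF v] by simp_all
    have g: "g > 0" "g * (1 + q v) = min d1 (1 - q (x - x0))"
      using pos(1) d1(1) x_diff(2) by (auto simp: g_def)
    have "g * 1 \<le> g * (1 + q v)" using g(1) pos(2) by (intro mult_left_mono) auto
    then have "g \<le> d1" using g(2) by simp
    show "\<exists>\<delta>>0. \<forall>y t. \<bar>q (y - x)\<bar> < \<delta> \<longrightarrow> 0 < t \<longrightarrow> t < \<delta> \<longrightarrow> y \<in> D \<longrightarrow> y + t *\<^sub>R (u + v) \<in> D \<longrightarrow>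
      h (y + t *\<^sub>R (u + v)) - h y \<le> (?p u + ?p v + e) * t"
    proof (intro exI[of _ "min d2 g"] conjI allI impI)
      fix y t
      assume *: "\<bar>q (y - x)\<bar> < min d2 g" "0 < t" "t < min d2 g" "y \<in> D" "y + t *\<^sub>R (u + v) \<in> D"
      have near: "y + t *\<^sub>R v - x \<in> S" "q (y + t *\<^sub>R v - x) < min d1 (1 - q (x - x0))"
        using near_add[OF v D_diff[OF *(4)], of g t] * g(2) by auto
      have mem: "y + t *\<^sub>R v \<in> D" using near by (intro near_mem) auto
      have eq: "y + t *\<^sub>R (u + v) = (y + t *\<^sub>R v) + t *\<^sub>R u" by (simp add: algebra_simps)
      have "h (y + t *\<^sub>R v + t *\<^sub>R u) - h (y + t *\<^sub>R v) \<le> (?p u + e / 2) * t"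
        using * near nonneg[OF near(1)] \<open>g \<le> d1\<close> mem by (intro d1(2)) (auto simp: eq)
      moreover have "h (y + t *\<^sub>R v) - h y \<le> (?p v + e / 2) * t"
        using * mem by (intro d2(2)) auto
      moreover have "(?p u + ?p v + e) * t = (?p u + e / 2) * t + (?p v + e / 2) * t"
        by (simp add: algebra_simps)
      ultimately show "h (y + t *\<^sub>R (u + v)) - h y \<le> (?p u + ?p v + e) * t"
        unfolding eq by linarith
    qed (use d2(1) g(1) in simp)
  qed
  then show "?p (u + v) \<le> ?p u + ?p v" using p_le subspace_add[OF S u v] by blast
next
  fix c :: real and v
  assume c: "c > 0" and v: "v \<in> S"
  have p: "clarke_derivative q D h x v \<le> ereal (?p v)"
    using clarke_derivative_real[OF v] by simp
  have "clarke_derivative q D h x (c *\<^sub>R v) \<le> ereal (c * ?p v)"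
    unfolding clarke_derivative_le_iff
  proof (intro allI impI)
    fix e :: real assume "e > 0"
    then have ec: "e / c > 0" using c by simp
    obtain d where d: "d > 0" "\<And>y t. \<bar>q (y - x)\<bar> < d \<Longrightarrow> 0 < t \<Longrightarrow> t < d \<Longrightarrow> y \<in> D
        \<Longrightarrow> y + t *\<^sub>R v \<in> D \<Longrightarrow> h (y + t *\<^sub>R v) - h y \<le> (?p v + e / c) * t"
      using clarke_derivative_leD[OF p ec] by blast
    show "\<exists>\<delta>>0. \<forall>y t. \<bar>q (y - x)\<bar> < \<delta> \<longrightarrow> 0 < t \<longrightarrow> t < \<delta> \<longrightarrow> y \<in> D \<longrightarrow> y + t *\<^sub>R c *\<^sub>R v \<in> D \<longrightarrow>
      h (y + t *\<^sub>R c *\<^sub>R v) - h y \<le> (c * ?p v + e) * t"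
    proof (intro exI[of _ "min d (d / c)"] conjI allI impI)
      fix y t
      assume *: "\<bar>q (y - x)\<bar> < min d (d / c)" "0 < t" "t < min d (d / c)" "y \<in> D"
        "y + t *\<^sub>R c *\<^sub>R v \<in> D"
      \<comment> \<open>The bound \<open>t < d / c\<close> makes the new step \<open>t * c\<close>
        smaller than \<open>d\<close>, and the slack \<open>e / c\<close> times \<open>t * c\<close>
        is \<open>e * t\<close>.\<close>
      have "h (y + (t * c) *\<^sub>R v) - h y \<le> (?p v + e / c) * (t * c)"
        using * c by (intro d(2)) (auto simp: field_simps)
      also have "\<dots> = (c * ?p v + e) * t" using c by (simp add: field_simps)
      finally show "h (y + t *\<^sub>R c *\<^sub>R v) - h y \<le> (c * ?p v + e) * t" by simp
    qed (use d(1) c in simp)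
  qed
  then show "?p (c *\<^sub>R v) \<le> c * ?p v"
    using clarke_derivative_real[OF subspace_scale[OF S v, of c]] by (metis ereal_less_eq(3))
qed

end

text \<open>Nonnegativity makes smallness of \<open>q + q'\<close> at \<open>y - x\<close> imply
  smallness of each summand, so the estimates for \<open>f\<close> and \<open>g\<close>, each with
  slack \<open>e / 2\<close>, hold at the same pairs and add up.\<close>

lemma clarke_derivative_add_le:
  assumes f: "clarke_derivative q D f x v \<le> ereal a" and g: "clarke_derivative q' D' g x v \<le> ereal b"
    and nonneg: "\<And>y. y \<in> D \<inter> D' \<Longrightarrow> 0 \<le> q (y - x) \<and> 0 \<le> q' (y - x)"
  shows "clarke_derivative (q + q') (D' \<inter> D) (f + g) x v \<le> ereal (a + b)"
  unfolding clarke_derivative_le_iff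
proof (intro allI impI)
  fix e :: real assume "e > 0"
  then have e2: "e / 2 > 0" by simp
  obtain d1 where d1: "d1 > 0" "\<And>y t. \<bar>q (y - x)\<bar> < d1 \<Longrightarrow> 0 < t \<Longrightarrow> t < d1 \<Longrightarrow> y \<in> D
      \<Longrightarrow> y + t *\<^sub>R v \<in> D \<Longrightarrow> f (y + t *\<^sub>R v) - f y \<le> (a + e / 2) * t"
    using clarke_derivative_leD[OF f e2] by blast
  obtain d2 where d2: "d2 > 0" "\<And>y t. \<bar>q' (y - x)\<bar> < d2 \<Longrightarrow> 0 < t \<Longrightarrow> t < d2 \<Longrightarrow> y \<in> D'
      \<Longrightarrow> y + t *\<^sub>R v \<in> D' \<Longrightarrow> g (y + t *\<^sub>R v) - g y \<le> (b + e / 2) * t"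
    using clarke_derivative_leD[OF g e2] by blast
  show "\<exists>\<delta>>0. \<forall>y t. \<bar>(q + q') (y - x)\<bar> < \<delta> \<longrightarrow> 0 < t \<longrightarrow> t < \<delta> \<longrightarrow> y \<in> D' \<inter> D \<longrightarrow>
      y + t *\<^sub>R v \<in> D' \<inter> D \<longrightarrow> (f + g) (y + t *\<^sub>R v) - (f + g) y \<le> (a + b + e) * t"
  proof (intro exI[of _ "min d1 d2"] conjI allI impI)
    fix y t
    assume *: "\<bar>(q + q') (y - x)\<bar> < min d1 d2" "0 < t" "t < min d1 d2" "y \<in> D' \<inter> D"
      "y + t *\<^sub>R v \<in> D' \<inter> D"
    then have "\<bar>q (y - x)\<bar> < d1" "\<bar>q' (y - x)\<bar> < d2" using nonneg[of y] by auto
    then have "f (y + t *\<^sub>R v) - f y \<le> (a + e / 2) * t" "g (y + t *\<^sub>R v) - g y \<le> (b + e / 2) * t"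
      using * by (auto intro!: d1(2) d2(2))
    then show "(f + g) (y + t *\<^sub>R v) - (f + g) y \<le> (a + b + e) * t"
      by (simp add: algebra_simps)
  qed (use d1(1) d2(1) in simp)
qed

section \<open>The sum rule for Minkowski functionals\<close>

lemma clarke_setting_minkowski:
  assumes D: "convex D" "x0 \<in> D" "symmetric_about D x0"
    and X0: "X0 = span ((\<lambda>x. x - x0) ` D)" and q: "q = minkowski ((\<lambda>x. x - x0) ` D)"
    and h: "seminorm_lipschitz_on q D h" and x: "x \<in> seminorm_ball X0 q x0 1"
  shows "clarke_setting X0 q D h x0 x"
proof -
  interpret K: absorbing_convex "(\<lambda>x. x - x0) ` D" by (rule absorbing_convex_translate[OF D])
  interpret seminorm_on X0 q unfolding X0 q by (rule K.seminorm_on_axioms)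
  show ?thesis
  proof
    show "y - x0 \<in> X0" if "y \<in> D" for y unfolding X0 using that by (intro span_base imageI)
    show "seminorm_ball X0 q x0 1 \<subseteq> D"
    proof
      fix y assume "y \<in> seminorm_ball X0 q x0 1"
      then have "y - x0 \<in> (\<lambda>x. x - x0) ` D"
        using K.mem_of_minkowski_less_1 by (simp add: seminorm_ball_def X0 q)
      then show "y \<in> D" by auto
    qed
  qed (fact h x)+
qed

theorem theorem3p3:
  fixes Q C X0 :: "'a::real_vector set" and x0 :: 'a
    and \<phi> f \<mu> \<nu> :: "'a \<Rightarrow> real"
  assumes "convex Q" and "convex C" and "Q \<inter> C \<noteq> {}"
    and "x0 \<in> Q \<inter> C"
    and "symmetric_about Q x0" and "symmetric_about C x0"
    and "X0 = span ((\<lambda>x. x - x0) ` C)"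
    and "span ((\<lambda>x. x - x0) ` C) = span ((\<lambda>x. x - x0) ` Q)"
    and "\<mu> = minkowski ((\<lambda>x. x - x0) ` C)"
    and "\<nu> = minkowski ((\<lambda>x. x - x0) ` Q)"
    and "seminorm_lipschitz_on \<mu> C \<phi>"
    and "seminorm_lipschitz_on \<nu> Q f"
  shows "\<forall>x \<in> seminorm_ball X0 \<mu> x0 1 \<inter> seminorm_ball X0 \<nu> x0 1.
    clarke_subdifferential X0 (\<mu> + \<nu>) (Q \<inter> C) (\<phi> + f) x
      \<subseteq> clarke_subdifferential X0 \<mu> C \<phi> x + clarke_subdifferential X0 \<nu> Q f x"
proof
  fix x
  assume x: "x \<in> seminorm_ball X0 \<mu> x0 1 \<inter> seminorm_ball X0 \<nu> x0 1"
  interpret \<phi>: clarke_setting X0 \<mu> C \<phi> x0 x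
    by (rule clarke_setting_minkowski) (use assms x in auto)
  interpret f: clarke_setting X0 \<nu> Q f x0 x
    by (rule clarke_setting_minkowski) (use assms x in auto)
  \<comment> \<open>Both derivatives are finite on \<open>X0\<close>, so passing to real values
    loses nothing there.\<close>
  let ?p = "\<lambda>v. real_of_ereal (clarke_derivative \<mu> C \<phi> x v)"
  let ?q = "\<lambda>v. real_of_ereal (clarke_derivative \<nu> Q f x v)"
  show "clarke_subdifferential X0 (\<mu> + \<nu>) (Q \<inter> C) (\<phi> + f) x
      \<subseteq> clarke_subdifferential X0 \<mu> C \<phi> x + clarke_subdifferential X0 \<nu> Q f x"
  proof
    fix k
    assume k: "k \<in> clarke_subdifferential X0 (\<mu> + \<nu>) (Q \<inter> C) (\<phi> + f) x"
    \<comment> \<open>This is the domination that lets \<open>k\<close> split into a part below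
      \<open>?p\<close> and a part below \<open>?q\<close>.\<close>
    have "k v \<le> ?p v + ?q v" if v: "v \<in> X0" for v
    proof -
      have "ereal (k v) \<le> clarke_derivative (\<mu> + \<nu>) (Q \<inter> C) (\<phi> + f) x v"
        using k v by (simp add: clarke_subdifferential_def)
      also have "\<dots> \<le> ereal (?p v + ?q v)"
        using \<phi>.clarke_derivative_real[OF v] f.clarke_derivative_real[OF v]
          \<phi>.nonneg[OF \<phi>.D_diff] f.nonneg[OF f.D_diff]
        by (intro clarke_derivative_add_le) auto
      finally show ?thesis by simp
    qed
    moreover have "k \<in> algebraic_dual X0" using k by (simp add: clarke_subdifferential_def)
    ultimately obtain l m where lm: "l \<in> algebraic_dual X0" "m \<in> algebraic_dual X0" "k = l + m"
      "\<And>v. v \<in> X0 \<Longrightarrow> l v \<le> ?p v" "\<And>v. v \<in> X0 \<Longrightarrow> m v \<le> ?q v"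
      using algebraic_dual_decompose[OF \<phi>.S \<phi>.sublinear_on_clarke_derivative
          f.sublinear_on_clarke_derivative] by blast
    have "ereal (l v) \<le> clarke_derivative \<mu> C \<phi> x v" "ereal (m v) \<le> clarke_derivative \<nu> Q f x v"
      if "v \<in> X0" for v
      using lm(4,5)[OF that] \<phi>.clarke_derivative_real[OF that] f.clarke_derivative_real[OF that]
      by (metis ereal_less_eq(3))+
    then show "k \<in> clarke_subdifferential X0 \<mu> C \<phi> x + clarke_subdifferential X0 \<nu> Q f x"
      unfolding lm(3) using lm(1,2)
      by (intro set_plus_intro) (simp_all add: clarke_subdifferential_def)
  qed
qed

end
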